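(* Every formula $\phi$ of the form $F\wedge \forall \bar{x}\;.\; Q$ that has a satisfiability certificate is satisfiable.
   Context: Setting: $F$ and $Q$ are quantifier-free formulas. The quantified variables $\bar{x}=(x_1,\dots,x_n)$ (so $n$ is the number of quantified variables) have a sort $\mathbb{D}$. All uninterpreted function symbols have domain $\mathbb{D}$ and codomain $\mathbb{D}'$. Both $\mathbb{D}$ and $\mathbb{D}'$ have canonical models of the same name, with $\mathbb{D}$ countable. Every $z\in\mathbb{D}$ has an interpreted constant $\hat z$ denoting it. Arguments of uninterpreted function symbols contain no uninterpreted function symbols of non-zero arity. For $z\in\mathbb{D}^n$, $Q[\bar x\mapsto \hat z]$ denotes the result of substituting the constants $\hat z$ for $\bar x$ in $Q$. A cell is a term $f(n_1,\dots,n_k)$ with $f$ uninterpreted and $n_i\in\mathbb{D}$. A cell interpretation $I$ is a partial function from cells to $\mathbb{D}'$; $\mathit{def}(I)$ is its domain. An interpretation is compatible with $I$ if it agrees with $I$ where $I$ is defined. For a term $t$, $I(t)$ is the value of $t$ if it is the same in every compatible interpretation, else $\bot$. $I\models\psi$ means every compatible interpretation satisfies $\psi$. A pre-satisfiability certificate of $\phi$ is a cell interpretation $I$ with $I\models F$ and such that for every $z\in\mathbb{D}^n$, every uninterpreted $f$ and every argument term $t$ of $f$ in $Q$, $I(t[\bar x\mapsto\hat z])\neq\bot$. The relevant cells are $\Gamma_{I,z}(\phi)=\{f(I(t[\bar x\mapsto\hat z]))\mid t \text{ an argument term of } f \text{ in } Q,\ f \text{ uninterpreted}\}$. A satisfiability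 certificate for $\phi$ consists of: a pre-satisfiability certificate $I$ of $\phi$; a well-order $\preceq$ on $\mathbb{D}^n$; and for every $z\in\mathbb{D}^n$, a set $X_z\subseteq\Gamma_{I,z}(\phi)$ of propagated cells with $X_z\cap\mathit{def}(I)=\emptyset$ and $X_z\cap\bigcup_{z'\prec z}\Gamma_{I,z'}(\phi)=\emptyset$, together with a satisfiability propagator showing that for all values of the cells in $\Gamma_{I,z}(\phi)\setminus\mathit{def}(I)\setminus X_z$ there exist values for the cells in $X_z$ such that, for the cell interpretation $I_{X_z}$ assigning these values, $I\cup I_{X_z}\models Q[\bar x\mapsto\hat z]$. *)

theory Defs
  imports "HOL-Library.Countable_Set"
begin

text \<open>
  A many-sorted signature together with its canonical models. All canonical models live in one
  type \<open>'u\<close>; \<open>universe\<close> gives the canonical model of each sort. The sort \<open>dsort\<close> of the variables and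
  of the arguments of uninterpreted function symbols and the sort \<open>csort\<close> of the values of those
  symbols may or may not coincide, and there may be further sorts. Interpreted symbols have a
  fixed meaning; uninterpreted symbols \<open>'f\<close> only have an arity, and arity 0 gives the uninterpreted
  constants.
\<close>

record ('s, 'u, 'f, 'g, 'p) sig =
  universe :: "'s \<Rightarrow> 'u set"
  dsort :: 's
  csort :: 's
  arity :: "'f \<Rightarrow> nat"
  fun_args :: "'g \<Rightarrow> 's list"
  fun_res :: "'g \<Rightarrow> 's"
  fun_interp :: "'g \<Rightarrow> 'u list \<Rightarrow> 'u"
  pred_args :: "'p \<Rightarrow> 's list"
  pred_interp :: "'p \<Rightarrow> 'u list \<Rightarrow> bool"
  hat :: "'u \<Rightarrow> 'g"

abbreviation ddom :: "('s, 'u, 'f, 'g, 'p) sig \<Rightarrow> 'u set" where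
  "ddom S \<equiv> universe S (dsort S)"

abbreviation cdom :: "('s, 'u, 'f, 'g, 'p) sig \<Rightarrow> 'u set" where
  "cdom S \<equiv> universe S (csort S)"

definition canonical_sig :: "('s, 'u, 'f, 'g, 'p) sig \<Rightarrow> bool" where
  "canonical_sig S \<longleftrightarrow>
     (\<forall>s. universe S s \<noteq> {}) \<and>
     countable (ddom S) \<and>
     (\<forall>g us. list_all2 (\<lambda>u s. u \<in> universe S s) us (fun_args S g) \<longrightarrow>
        fun_interp S g us \<in> universe S (fun_res S g)) \<and>
     (\<forall>z \<in> ddom S. fun_args S (hat S z) = [] \<and> fun_res S (hat S z) = dsort S \<and>
        fun_interp S (hat S z) [] = z)"


section \<open>Syntax\<close>

datatype ('v, 'f, 'g) tm =
    Var 'v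
  | IApp 'g "('v, 'f, 'g) tm list"
  | UApp 'f "('v, 'f, 'g) tm list"

datatype ('v, 'f, 'g, 'p) fm =
    Pred 'p "('v, 'f, 'g) tm list"
  | Eq "('v, 'f, 'g) tm" "('v, 'f, 'g) tm"
  | Neg "('v, 'f, 'g, 'p) fm"
  | Conj "('v, 'f, 'g, 'p) fm" "('v, 'f, 'g, 'p) fm"
  | Disj "('v, 'f, 'g, 'p) fm" "('v, 'f, 'g, 'p) fm"
  | All 'v "('v, 'f, 'g, 'p) fm"

definition Alls :: "'v list \<Rightarrow> ('v, 'f, 'g, 'p) fm \<Rightarrow> ('v, 'f, 'g, 'p) fm" where
  "Alls xs Q = foldr All xs Q"

fun has_sort :: "('s, 'u, 'f, 'g, 'p) sig \<Rightarrow> ('v, 'f, 'g) tm \<Rightarrow> 's \<Rightarrow> bool" where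
  "has_sort S (Var x) s \<longleftrightarrow> s = dsort S"
| "has_sort S (IApp g ts) s \<longleftrightarrow> s = fun_res S g \<and> list_all2 (has_sort S) ts (fun_args S g)"
| "has_sort S (UApp f ts) s \<longleftrightarrow>
     s = csort S \<and> length ts = arity S f \<and> (\<forall>t \<in> set ts. has_sort S t (dsort S))"

fun well_sorted :: "('s, 'u, 'f, 'g, 'p) sig \<Rightarrow> ('v, 'f, 'g, 'p) fm \<Rightarrow> bool" where
  "well_sorted S (Pred p ts) \<longleftrightarrow> list_all2 (has_sort S) ts (pred_args S p)"
| "well_sorted S (Eq t u) \<longleftrightarrow> (\<exists>s. has_sort S t s \<and> has_sort S u s)"
| "well_sorted S (Neg A) \<longleftrightarrow> well_sorted S A"
| "well_sorted S (Conj A B) \<longleftrightarrow> well_sorted S A \<and> well_sorted S B"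
| "well_sorted S (Disj A B) \<longleftrightarrow> well_sorted S A \<and> well_sorted S B"
| "well_sorted S (All x A) \<longleftrightarrow> well_sorted S A"

fun qfree :: "('v, 'f, 'g, 'p) fm \<Rightarrow> bool" where
  "qfree (Pred p ts) \<longleftrightarrow> True"
| "qfree (Eq t u) \<longleftrightarrow> True"
| "qfree (Neg A) \<longleftrightarrow> qfree A"
| "qfree (Conj A B) \<longleftrightarrow> qfree A \<and> qfree B"
| "qfree (Disj A B) \<longleftrightarrow> qfree A \<and> qfree B"
| "qfree (All x A) \<longleftrightarrow> False"

text \<open>
  The pairs \<open>(f, ts)\<close> such that the uninterpreted symbol \<open>f\<close> occurs with argument tuple \<open>ts\<close>. For
  an uninterpreted constant \<open>f\<close> this is \<open>(f, [])\<close>, also if it occurs inside an argument.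
\<close>

fun tm_apps :: "('v, 'f, 'g) tm \<Rightarrow> ('f \<times> ('v, 'f, 'g) tm list) set" where
  "tm_apps (Var x) = {}"
| "tm_apps (IApp g ts) = (\<Union>t \<in> set ts. tm_apps t)"
| "tm_apps (UApp f ts) = insert (f, ts) (\<Union>t \<in> set ts. tm_apps t)"

fun fm_apps :: "('v, 'f, 'g, 'p) fm \<Rightarrow> ('f \<times> ('v, 'f, 'g) tm list) set" where
  "fm_apps (Pred p ts) = (\<Union>t \<in> set ts. tm_apps t)"
| "fm_apps (Eq t u) = tm_apps t \<union> tm_apps u"
| "fm_apps (Neg A) = fm_apps A"
| "fm_apps (Conj A B) = fm_apps A \<union> fm_apps B"
| "fm_apps (Disj A B) = fm_apps A \<union> fm_apps B"
| "fm_apps (All x A) = fm_apps A"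

definition simple_args :: "('s, 'u, 'f, 'g, 'p) sig \<Rightarrow> ('v, 'f, 'g, 'p) fm \<Rightarrow> bool" where
  "simple_args S A \<longleftrightarrow>
     (\<forall>(f, ts) \<in> fm_apps A. \<forall>t \<in> set ts. \<forall>(g, us) \<in> tm_apps t. arity S g = 0)"

text \<open>
  Substitution of terms for the variables in the domain of a finite map. It is only applied with
  closed terms below, so no renaming of bound variables is needed.
\<close>

fun tm_subst :: "('v \<rightharpoonup> ('v, 'f, 'g) tm) \<Rightarrow> ('v, 'f, 'g) tm \<Rightarrow> ('v, 'f, 'g) tm" where
  "tm_subst \<theta> (Var x) = (case \<theta> x of None \<Rightarrow> Var x | Some t \<Rightarrow> t)"
| "tm_subst \<theta> (IApp g ts) = IApp g (map (tm_subst \<theta>) ts)"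
| "tm_subst \<theta> (UApp f ts) = UApp f (map (tm_subst \<theta>) ts)"

fun fm_subst :: "('v \<rightharpoonup> ('v, 'f, 'g) tm) \<Rightarrow> ('v, 'f, 'g, 'p) fm \<Rightarrow> ('v, 'f, 'g, 'p) fm" where
  "fm_subst \<theta> (Pred p ts) = Pred p (map (tm_subst \<theta>) ts)"
| "fm_subst \<theta> (Eq t u) = Eq (tm_subst \<theta> t) (tm_subst \<theta> u)"
| "fm_subst \<theta> (Neg A) = Neg (fm_subst \<theta> A)"
| "fm_subst \<theta> (Conj A B) = Conj (fm_subst \<theta> A) (fm_subst \<theta> B)"
| "fm_subst \<theta> (Disj A B) = Disj (fm_subst \<theta> A) (fm_subst \<theta> B)"
| "fm_subst \<theta> (All x A) = All x (fm_subst (\<theta>(x := None)) A)"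

definition hat_subst ::
  "('s, 'u, 'f, 'g, 'p) sig \<Rightarrow> 'v list \<Rightarrow> 'u list \<Rightarrow> ('v \<rightharpoonup> ('v, 'f, 'g) tm)" where
  "hat_subst S xs z = map_of (zip xs (map (\<lambda>a. IApp (hat S a) []) z))"

definition tuples :: "('s, 'u, 'f, 'g, 'p) sig \<Rightarrow> nat \<Rightarrow> 'u list set" where
  "tuples S n = {z. length z = n \<and> set z \<subseteq> ddom S}"


section \<open>Semantics\<close>

text \<open>
  A cell \<open>f(n\<^sub>1, \<dots>, n\<^sub>k)\<close> is represented as the pair of \<open>f\<close> and \<open>[n\<^sub>1, \<dots>, n\<^sub>k]\<close>. Since the meaning of
  the interpreted symbols is fixed, an interpretation amounts to a function on cells, together
  with an assignment for the variables that occur free.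
\<close>

type_synonym ('f, 'u) cell = "'f \<times> 'u list"

definition cells :: "('s, 'u, 'f, 'g, 'p) sig \<Rightarrow> ('f, 'u) cell set" where
  "cells S = {(f, ns). length ns = arity S f \<and> set ns \<subseteq> ddom S}"

definition interpretation_of ::
  "('s, 'u, 'f, 'g, 'p) sig \<Rightarrow> (('f, 'u) cell \<Rightarrow> 'u) \<Rightarrow> ('v \<Rightarrow> 'u) \<Rightarrow> bool" where
  "interpretation_of S J \<sigma> \<longleftrightarrow> (\<forall>c \<in> cells S. J c \<in> cdom S) \<and> (\<forall>x. \<sigma> x \<in> ddom S)"

fun eval :: "('s, 'u, 'f, 'g, 'p) sig \<Rightarrow> (('f, 'u) cell \<Rightarrow> 'u) \<Rightarrow> ('v \<Rightarrow> 'u) \<Rightarrow>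
    ('v, 'f, 'g) tm \<Rightarrow> 'u" where
  "eval S J \<sigma> (Var x) = \<sigma> x"
| "eval S J \<sigma> (IApp g ts) = fun_interp S g (map (eval S J \<sigma>) ts)"
| "eval S J \<sigma> (UApp f ts) = J (f, map (eval S J \<sigma>) ts)"

fun sat :: "('s, 'u, 'f, 'g, 'p) sig \<Rightarrow> (('f, 'u) cell \<Rightarrow> 'u) \<Rightarrow> ('v \<Rightarrow> 'u) \<Rightarrow>
    ('v, 'f, 'g, 'p) fm \<Rightarrow> bool" where
  "sat S J \<sigma> (Pred p ts) \<longleftrightarrow> pred_interp S p (map (eval S J \<sigma>) ts)"
| "sat S J \<sigma> (Eq t u) \<longleftrightarrow> eval S J \<sigma> t = eval S J \<sigma> u"
| "sat S J \<sigma> (Neg A) \<longleftrightarrow> \<not> sat S J \<sigma> A"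
| "sat S J \<sigma> (Conj A B) \<longleftrightarrow> sat S J \<sigma> A \<and> sat S J \<sigma> B"
| "sat S J \<sigma> (Disj A B) \<longleftrightarrow> sat S J \<sigma> A \<or> sat S J \<sigma> B"
| "sat S J \<sigma> (All x A) \<longleftrightarrow> (\<forall>a \<in> ddom S. sat S J (\<sigma>(x := a)) A)"

definition satisfiable :: "('s, 'u, 'f, 'g, 'p) sig \<Rightarrow> ('v, 'f, 'g, 'p) fm \<Rightarrow> bool" where
  "satisfiable S A \<longleftrightarrow> (\<exists>J \<sigma>. interpretation_of S J \<sigma> \<and> sat S J \<sigma> A)"


section \<open>Cell interpretations\<close>

type_synonym ('f, 'u) cell_interp = "('f, 'u) cell \<rightharpoonup> 'u"

definition cell_interp :: "('s, 'u, 'f, 'g, 'p) sig \<Rightarrow> ('f, 'u) cell_interp \<Rightarrow> bool" where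
  "cell_interp S I \<longleftrightarrow> dom I \<subseteq> cells S \<and> ran I \<subseteq> cdom S"

definition compatible :: "('s, 'u, 'f, 'g, 'p) sig \<Rightarrow> ('f, 'u) cell_interp \<Rightarrow>
    (('f, 'u) cell \<Rightarrow> 'u) \<Rightarrow> ('v \<Rightarrow> 'u) \<Rightarrow> bool" where
  "compatible S I J \<sigma> \<longleftrightarrow> interpretation_of S J \<sigma> \<and> (\<forall>c \<in> dom I. I c = Some (J c))"

text \<open>\<open>None\<close> plays the role of \<open>\<bottom>\<close>.\<close>

definition cell_eval :: "('s, 'u, 'f, 'g, 'p) sig \<Rightarrow> ('f, 'u) cell_interp \<Rightarrow>
    ('v, 'f, 'g) tm \<Rightarrow> 'u option" where
  "cell_eval S I t =
     (if \<exists>v. \<forall>J \<sigma>. compatible S I J \<sigma> \<longrightarrow> eval S J \<sigma> t = v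
      then Some (THE v. \<forall>J \<sigma>. compatible S I J \<sigma> \<longrightarrow> eval S J \<sigma> t = v)
      else None)"

definition cell_models :: "('s, 'u, 'f, 'g, 'p) sig \<Rightarrow> ('f, 'u) cell_interp \<Rightarrow>
    ('v, 'f, 'g, 'p) fm \<Rightarrow> bool" where
  "cell_models S I A \<longleftrightarrow> (\<forall>J \<sigma>. compatible S I J \<sigma> \<longrightarrow> sat S J \<sigma> A)"


section \<open>Certificates for \<open>Conj F (Alls xs Q)\<close>\<close>

definition presat_certificate :: "('s, 'u, 'f, 'g, 'p) sig \<Rightarrow> ('v, 'f, 'g, 'p) fm \<Rightarrow> 'v list \<Rightarrow>
    ('v, 'f, 'g, 'p) fm \<Rightarrow> ('f, 'u) cell_interp \<Rightarrow> bool" where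
  "presat_certificate S F xs Q I \<longleftrightarrow>
     cell_interp S I \<and> cell_models S I F \<and>
     (\<forall>z \<in> tuples S (length xs). \<forall>(f, ts) \<in> fm_apps Q. \<forall>t \<in> set ts.
        cell_eval S I (tm_subst (hat_subst S xs z) t) \<noteq> None)"

definition relevant_cells :: "('s, 'u, 'f, 'g, 'p) sig \<Rightarrow> 'v list \<Rightarrow> ('v, 'f, 'g, 'p) fm \<Rightarrow>
    ('f, 'u) cell_interp \<Rightarrow> 'u list \<Rightarrow> ('f, 'u) cell set" where
  "relevant_cells S xs Q I z =
     (\<lambda>(f, ts). (f, map (\<lambda>t. the (cell_eval S I (tm_subst (hat_subst S xs z) t))) ts)) ` fm_apps Q"

text \<open>
  What a satisfiability propagator establishes: for all values \<open>A\<close> of the relevant cells that are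
  neither fixed by \<open>I\<close> nor propagated, there are values \<open>B\<close> of the propagated cells \<open>X\<close> such that \<open>I\<close>
  extended by all of these values entails the instance of \<open>Q\<close>.
\<close>

definition sat_propagation :: "('s, 'u, 'f, 'g, 'p) sig \<Rightarrow> 'v list \<Rightarrow> ('v, 'f, 'g, 'p) fm \<Rightarrow>
    ('f, 'u) cell_interp \<Rightarrow> 'u list \<Rightarrow> ('f, 'u) cell set \<Rightarrow> bool" where
  "sat_propagation S xs Q I z X \<longleftrightarrow>
     (\<forall>A. cell_interp S A \<and> dom A = relevant_cells S xs Q I z - dom I - X \<longrightarrow>
        (\<exists>B. cell_interp S B \<and> dom B = X \<and>
           cell_models S (I ++ (A ++ B)) (fm_subst (hat_subst S xs z) Q)))"

definition sat_certificate :: "('s, 'u, 'f, 'g, 'p) sig \<Rightarrow> ('v, 'f, 'g, 'p) fm \<Rightarrow> 'v list \<Rightarrow>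
    ('v, 'f, 'g, 'p) fm \<Rightarrow> ('f, 'u) cell_interp \<Rightarrow> 'u list rel \<Rightarrow>
    ('u list \<Rightarrow> ('f, 'u) cell set) \<Rightarrow> bool" where
  "sat_certificate S F xs Q I r X \<longleftrightarrow>
     presat_certificate S F xs Q I \<and>
     well_order_on (tuples S (length xs)) r \<and>
     (\<forall>z \<in> tuples S (length xs).
        X z \<subseteq> relevant_cells S xs Q I z \<and>
        X z \<inter> dom I = {} \<and>
        X z \<inter> (\<Union>z' \<in> {z'. (z', z) \<in> r \<and> z' \<noteq> z}. relevant_cells S xs Q I z') = {} \<and>
        sat_propagation S xs Q I z (X z))"

end

(*
  The values of the propagated cells are chosen by well-founded recursion along the well-order. The
  propagator for z needs the values of the relevant cells of z that z does not propagate; such a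
  cell is either propagated by some earlier tuple, and then its value is already known, or it is
  propagated by no tuple at all, since tuples after z may not propagate relevant cells of z, and
  then any default value will do.
*)
theory Submission
  imports Defs
begin

section \<open>Substitution and blocks of quantifiers\<close>

lemma eval_tm_subst:
  "eval S J \<sigma> (tm_subst \<theta> t) =
     eval S J (\<lambda>x. case \<theta> x of None \<Rightarrow> \<sigma> x | Some u \<Rightarrow> eval S J \<sigma> u) t"
proof (induction t)
  case (IApp g ts)
  then have "map (eval S J \<sigma> \<circ> tm_subst \<theta>) ts =
      map (eval S J (\<lambda>x. case \<theta> x of None \<Rightarrow> \<sigma> x | Some u \<Rightarrow> eval S J \<sigma> u)) ts"
    by simp
  then show ?case by (simp only: tm_subst.simps eval.simps map_map)
next
  case (UApp f ts)
  then have "map (eval S J \<sigma> \<circ> tm_subst \<theta>) ts =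
      map (eval S J (\<lambda>x. case \<theta> x of None \<Rightarrow> \<sigma> x | Some u \<Rightarrow> eval S J \<sigma> u)) ts"
    by simp
  then show ?case by (simp only: tm_subst.simps eval.simps map_map)
qed (simp split: option.split)

text \<open>Without quantifiers only terms change, and no binder can capture a variable of a
  substituted term, so \<open>eval_tm_subst\<close> carries over to formulas.\<close>

lemma sat_fm_subst:
  assumes "qfree A"
  shows "sat S J \<sigma> (fm_subst \<theta> A) \<longleftrightarrow>
    sat S J (\<lambda>x. case \<theta> x of None \<Rightarrow> \<sigma> x | Some u \<Rightarrow> eval S J \<sigma> u) A"
  using assms by (induction A) (simp_all add: eval_tm_subst comp_def)

text \<open>Each constant \<open>hat S a\<close> with \<open>a\<close> in \<open>ddom S\<close>
  denotes \<open>a\<close>. Together with \<open>sat_fm_subst\<close> this turns an instance of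
  \<open>Q\<close> into \<open>Q\<close> under one of the assignments that occur in
  \<open>sat_Alls\<close>.\<close>

lemma eval_hat_subst:
  assumes "canonical_sig S" and "set z \<subseteq> ddom S"
  shows "(case hat_subst S xs z x of None \<Rightarrow> \<sigma> x | Some u \<Rightarrow> eval S J \<sigma> u) =
    (case map_of (zip xs z) x of None \<Rightarrow> \<sigma> x | Some a \<Rightarrow> a)"
proof -
  have "hat_subst S xs z x = map_option (\<lambda>a. IApp (hat S a) []) (map_of (zip xs z) x)"
    by (simp add: hat_subst_def zip_map2 map_of_map)
  moreover have "fun_interp S (hat S a) [] = a" if "map_of (zip xs z) x = Some a" for a
    using assms map_of_SomeD[OF that] unfolding canonical_sig_def
    by (blast dest: set_zip_rightD)
  ultimately show ?thesis by (simp split: option.split)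
qed

text \<open>One quantifier is peeled off at a time. Nested quantifiers let the innermost update win,
  while \<open>map_of\<close> prefers the first pair; with \<open>distinct xs\<close> no variable is
  bound twice and both give the same assignment.\<close>

lemma sat_Alls:
  assumes "distinct xs"
  shows "sat S J \<sigma> (Alls xs A) \<longleftrightarrow>
    (\<forall>z \<in> tuples S (length xs).
       sat S J (\<lambda>x. case map_of (zip xs z) x of None \<Rightarrow> \<sigma> x | Some a \<Rightarrow> a) A)"
  using assms
proof (induction xs arbitrary: \<sigma>)
  case Nil
  have "tuples S 0 = {[]}" by (auto simp: tuples_def)
  then show ?case by (simp add: Alls_def)
next
  case (Cons y ys)
  have split: "(\<forall>z \<in> tuples S (length (y # ys)). P z) \<longleftrightarrow>
      (\<forall>a \<in> ddom S. \<forall>z \<in> tuples S (length ys). P (a # z))" for P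
    by (force simp: tuples_def length_Suc_conv)
  have upd: "(\<lambda>x. case map_of (zip ys z) x of None \<Rightarrow> (\<sigma>(y := a)) x | Some b \<Rightarrow> b) =
      (\<lambda>x. case map_of (zip (y # ys) (a # z)) x of None \<Rightarrow> \<sigma> x | Some b \<Rightarrow> b)"
    if "z \<in> tuples S (length ys)" for a z
  proof
    have "map_of (zip ys z) y = None"
      using Cons.prems that by (simp add: tuples_def map_of_zip_is_None)
    then show "(case map_of (zip ys z) x of None \<Rightarrow> (\<sigma>(y := a)) x | Some b \<Rightarrow> b) =
      (case map_of (zip (y # ys) (a # z)) x of None \<Rightarrow> \<sigma> x | Some b \<Rightarrow> b)" for x
      by (simp split: option.split)
  qed
  have "sat S J \<sigma> (Alls (y # ys) A) \<longleftrightarrow> (\<forall>a \<in> ddom S. sat S J (\<sigma>(y := a)) (Alls ys A))"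
    by (simp add: Alls_def)
  also have "\<dots> \<longleftrightarrow> (\<forall>a \<in> ddom S. \<forall>z \<in> tuples S (length ys).
      sat S J (\<lambda>x. case map_of (zip ys z) x of None \<Rightarrow> (\<sigma>(y := a)) x | Some b \<Rightarrow> b) A)"
    using Cons by simp
  finally show ?case by (simp only: split upd cong: ball_cong)
qed

section \<open>Sorts of values and of argument tuples\<close>

lemma eval_in_universe:
  assumes "canonical_sig S" and "interpretation_of S J \<sigma>"
  shows "has_sort S t s \<Longrightarrow> eval S J \<sigma> t \<in> universe S s"
proof (induction t arbitrary: s)
  case (Var x)
  then show ?case using assms(2) by (simp add: interpretation_of_def)
next
  case (IApp g ts)
  then have "list_all2 (\<lambda>u s. u \<in> universe S s) (map (eval S J \<sigma>) ts) (fun_args S g)"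
    by (auto simp: list_all2_conv_all_nth)
  then show ?case using assms(1) IApp.prems by (simp add: canonical_sig_def)
next
  case (UApp f ts)
  then have "(f, map (eval S J \<sigma>) ts) \<in> cells S"
    by (auto simp: cells_def)
  then show ?case using assms(2) UApp.prems by (simp add: interpretation_of_def)
qed

lemma tm_apps_sorted:
  assumes "has_sort S t s" and "(f, ts) \<in> tm_apps t"
  shows "length ts = arity S f" and "\<forall>u \<in> set ts. has_sort S u (dsort S)"
proof -
  have "length ts = arity S f \<and> (\<forall>u \<in> set ts. has_sort S u (dsort S))"
    using assms
  proof (induction t arbitrary: s)
    case (IApp g us)
    then show ?case by (fastforce simp: list_all2_conv_all_nth in_set_conv_nth)
  qed auto
  then show "length ts = arity S f" and "\<forall>u \<in> set ts. has_sort S u (dsort S)" by auto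
qed

lemma fm_apps_sorted:
  assumes "well_sorted S A" and "(f, ts) \<in> fm_apps A"
  shows "length ts = arity S f" and "\<forall>u \<in> set ts. has_sort S u (dsort S)"
proof -
  have "length ts = arity S f \<and> (\<forall>u \<in> set ts. has_sort S u (dsort S))"
    using assms
  proof (induction A)
    case (Pred p us)
    then obtain u where "u \<in> set us" "(f, ts) \<in> tm_apps u" by auto
    moreover from this obtain s where "has_sort S u s"
      using Pred.prems by (auto simp: list_all2_conv_all_nth in_set_conv_nth)
    ultimately show ?case by (auto dest: tm_apps_sorted)
  next
    case (Eq t u)
    then show ?case by (auto dest: tm_apps_sorted)
  qed auto
  then show "length ts = arity S f" and "\<forall>u \<in> set ts. has_sort S u (dsort S)" by auto
qed

section \<open>Compatible interpretations and relevant cells\<close>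

lemma compatible_exists:
  assumes "canonical_sig S" and "cell_interp S I"
  obtains J and \<sigma> :: "'v \<Rightarrow> 'u" where "compatible (S :: ('s, 'u, 'f, 'g, 'p) sig) I J \<sigma>"
proof -
  \<comment> \<open>Canonical models are non-empty, so undefined cells and variables can take
    default values. Hence the condition in \<open>cell_eval\<close> is never vacuous.\<close>
  obtain d e where "d \<in> cdom S" "e \<in> ddom S"
    using assms(1) by (fastforce simp: canonical_sig_def)
  then have "compatible S I (\<lambda>c. case I c of None \<Rightarrow> d | Some v \<Rightarrow> v) (\<lambda>_. e)"
    using assms(2)
    by (auto simp: compatible_def interpretation_of_def cell_interp_def ran_def split: option.split)
  then show thesis by (rule that)
qed

text \<open>The given compatible interpretation pins down the value under \<open>THE\<close>, so a
  defined \<open>cell_eval\<close> can be computed in any such interpretation.\<close>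

lemma cell_eval_eq:
  assumes "compatible S I J \<sigma>" and "cell_eval S I t \<noteq> None"
  shows "cell_eval S I t = Some (eval S J \<sigma> t)"
proof -
  have "\<exists>v. \<forall>J \<sigma>. compatible S I J \<sigma> \<longrightarrow> eval S J \<sigma> t = v"
    using assms(2) unfolding cell_eval_def by (rule contrapos_np) simp
  then obtain v where v: "\<forall>J \<sigma>. compatible S I J \<sigma> \<longrightarrow> eval S J \<sigma> t = v" by blast
  then have "(THE v. \<forall>J \<sigma>. compatible S I J \<sigma> \<longrightarrow> eval S J \<sigma> t = v) = v"
    using assms(1) by (intro the_equality) blast+
  with v show ?thesis using assms(1) unfolding cell_eval_def by auto
qed

text \<open>Each argument value is the value of a term of sort \<open>dsort S\<close> in a
  compatible interpretation, and the arities match by well-sortedness. This makes the inputs of a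
  propagator legal cell interpretations.\<close>

lemma relevant_cells_subset:
  fixes Q :: "('v, 'f, 'g, 'p) fm" and S :: "('s, 'u, 'f, 'g, 'p) sig"
  assumes S: "canonical_sig S" and Q: "well_sorted S Q"
    and I: "presat_certificate S F xs Q I" and z: "z \<in> tuples S (length xs)"
  shows "relevant_cells S xs Q I z \<subseteq> cells S"
proof -
  have "cell_interp S I" using I by (simp add: presat_certificate_def)
  then obtain J and \<sigma> :: "'v \<Rightarrow> 'u" where J: "compatible S I J \<sigma>"
    using compatible_exists[OF S] by blast
  let ?\<sigma> = "\<lambda>x. case map_of (zip xs z) x of None \<Rightarrow> \<sigma> x | Some a \<Rightarrow> a"
  have zD: "set z \<subseteq> ddom S" using z by (simp add: tuples_def)
  have \<sigma>: "interpretation_of S J ?\<sigma>"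
    using J zD by (auto simp: compatible_def interpretation_of_def split: option.split
        dest!: map_of_SomeD set_zip_rightD)
  have "the (cell_eval S I (tm_subst (hat_subst S xs z) t)) \<in> ddom S"
    if ft: "(f, ts) \<in> fm_apps Q" and t: "t \<in> set ts" for f ts t
  proof -
    have "cell_eval S I (tm_subst (hat_subst S xs z) t) \<noteq> None"
      using I z ft t unfolding presat_certificate_def by fast
    then have "the (cell_eval S I (tm_subst (hat_subst S xs z) t)) = eval S J ?\<sigma> t"
      by (simp add: cell_eval_eq[OF J] eval_tm_subst eval_hat_subst[OF S zD])
    then show ?thesis
      using eval_in_universe[OF S \<sigma>] fm_apps_sorted(2)[OF Q ft] t by simp
  qed
  then show ?thesis
    using fm_apps_sorted(1)[OF Q] by (fastforce simp: relevant_cells_def cells_def)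
qed

section \<open>Choice of the propagated values and construction of the model\<close>

theorem theorem1:
  fixes S :: "('s, 'u, 'f, 'g, 'p) sig"
    and F Q :: "('v, 'f, 'g, 'p) fm"
    and xs :: "'v list"
  assumes "canonical_sig S"
    and "well_sorted S F" and "qfree F" and "simple_args S F"
    and "well_sorted S Q" and "qfree Q" and "simple_args S Q"
    and "distinct xs"
    and "\<exists>I r X. sat_certificate S F xs Q I r X"
  shows "satisfiable S (Conj F (Alls xs Q))"
proof -
  obtain I r X where cert: "sat_certificate S F xs Q I r X" using assms(9) by blast
  define T where "T = tuples S (length xs)"
  define \<Gamma> where "\<Gamma> = relevant_cells S xs Q I"
  define R where "R = r - Id"
  have pre: "presat_certificate S F xs Q I" and wo: "well_order_on T r"
    using cert by (auto simp: sat_certificate_def T_def)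
  have X\<Gamma>: "X z \<subseteq> \<Gamma> z" and XI: "X z \<inter> dom I = {}"
    and prop_X: "sat_propagation S xs Q I z (X z)" if "z \<in> T" for z
    using cert that by (auto simp: sat_certificate_def T_def \<Gamma>_def)
  have X_earlier: "X z \<inter> \<Gamma> y = {}" if "z \<in> T" "(y, z) \<in> R" for y z
    using cert that unfolding sat_certificate_def T_def \<Gamma>_def R_def by blast
  have wf: "wf R" using wo by (simp add: well_order_on_def R_def)
  have RT: "y \<in> T \<and> z \<in> T" if "(y, z) \<in> R" for y z
    using wo that by (auto simp: well_order_on_def linear_order_on_def partial_order_on_def
        preorder_on_def refl_on_def R_def)
  have total: "(y, z) \<in> R \<or> (z, y) \<in> R" if "y \<in> T" "z \<in> T" "y \<noteq> z" for y z
    using wo that by (auto simp: well_order_on_def linear_order_on_def total_on_def R_def)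
  have I: "cell_interp S I" and F: "cell_models S I F"
    using pre by (auto simp: presat_certificate_def)
  have \<Gamma>_cells: "\<Gamma> z \<subseteq> cells S" if "z \<in> T" for z
    using relevant_cells_subset[OF assms(1,5) pre] that by (simp add: \<Gamma>_def T_def)
  \<comment> \<open>Otherwise the later of the two tuples would propagate a cell that is relevant to
    the earlier one.\<close>
  have X_unique: "y = z" if "y \<in> T" "z \<in> T" "c \<in> X y" "c \<in> X z" for y z c
    using total[of y z] X_earlier[of y z] X_earlier[of z y] X\<Gamma>[of y] X\<Gamma>[of z] that by blast
  obtain d e where d: "d \<in> cdom S" and e: "e \<in> ddom S"
    using assms(1) by (fastforce simp: canonical_sig_def)
  \<comment> \<open>\<open>V b z\<close> is the input to the propagator at \<open>z\<close>, read
    off from the choices \<open>b\<close>. Consulting only \<open>R\<close>-predecessors of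
    \<open>z\<close> is what permits the recursion.\<close>
  define V where "V b z = (\<lambda>c. if c \<in> \<Gamma> z - dom I - X z then
      (if \<exists>y. (y, z) \<in> R \<and> c \<in> X y then b (SOME y. (y, z) \<in> R \<and> c \<in> X y) c else Some d)
      else None)"
    for b :: "'u list \<Rightarrow> ('f, 'u) cell_interp" and z
  \<comment> \<open>The recursion runs over all lists, so nothing is required outside
    \<open>T\<close>.\<close>
  define P where "P b z B \<longleftrightarrow> (z \<in> T \<longrightarrow> cell_interp S B \<and> dom B = X z \<and>
      cell_models S (I ++ (V b z ++ B)) (fm_subst (hat_subst S xs z) Q))"
    for b z B
  have V_earlier: "V b z c = b y c"
    if "(y, z) \<in> R" "c \<in> X y" "c \<in> \<Gamma> z - dom I - X z" for b y z c
  proof -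
    have "(SOME y. (y, z) \<in> R \<and> c \<in> X y) = y"
      using that RT X_unique by (intro some_equality) blast+
    then show ?thesis using that by (auto simp: V_def)
  qed
  have "\<exists>b. \<forall>z. P b z (b z)"
  \<comment> \<open>Two obligations: \<open>P b z\<close> depends on \<open>b\<close> only below
    \<open>z\<close>, and a suitable choice at \<open>z\<close> exists once all earlier choices are
    correct.\<close>
  proof (rule dependent_wf_choice[OF wf])
    fix b b' :: "'u list \<Rightarrow> ('f, 'u) cell_interp" and z B
    assume eq: "\<And>y. (y, z) \<in> R \<Longrightarrow> b y = b' y"
    have "V b z c = V b' z c" for c
    proof (cases "\<exists>y. (y, z) \<in> R \<and> c \<in> X y")
      case True
      then have "(SOME y. (y, z) \<in> R \<and> c \<in> X y, z) \<in> R" by (rule someI2_ex) simp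
      then show ?thesis unfolding V_def by (simp only: eq)
    qed (auto simp: V_def)
    then have "V b z = V b' z" by blast
    then show "P b z B = P b' z B" by (simp add: P_def)
  next
    fix z and b :: "'u list \<Rightarrow> ('f, 'u) cell_interp"
    assume IH: "\<And>y. (y, z) \<in> R \<Longrightarrow> P b y (b y)"
    show "\<exists>B. P b z B"
    proof (cases "z \<in> T")
      case True
      \<comment> \<open>An inherited value is legal by the induction hypothesis at the tuple
        \<open>y\<close> that propagates \<open>c\<close>; otherwise the value is
        \<open>d\<close>.\<close>
      have val: "\<exists>v \<in> cdom S. V b z c = Some v" if c: "c \<in> \<Gamma> z - dom I - X z" for c
      proof (cases "\<exists>y. (y, z) \<in> R \<and> c \<in> X y")
        case True
        then obtain y where y: "(y, z) \<in> R" "c \<in> X y" by blast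
        then have "cell_interp S (b y)" "c \<in> dom (b y)"
          using IH[OF y(1)] RT by (auto simp: P_def)
        then show ?thesis using V_earlier[OF y c] by (auto simp: cell_interp_def dest: ranI)
      next
        case False
        then show ?thesis using c d by (auto simp: V_def)
      qed
      \<comment> \<open>\<open>sat_propagation\<close> speaks only about inputs with exactly this
        domain.\<close>
      have dom: "dom (V b z) = \<Gamma> z - dom I - X z"
      proof
        show "dom (V b z) \<subseteq> \<Gamma> z - dom I - X z" by (auto simp: V_def split: if_splits)
        show "\<Gamma> z - dom I - X z \<subseteq> dom (V b z)" using val by blast
      qed
      have "v \<in> cdom S" if "V b z c = Some v" for c v
        using val[of c] that dom by (metis domI option.inject)
      then have "cell_interp S (V b z)"
        using dom \<Gamma>_cells[OF True] by (auto simp: cell_interp_def ran_def)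
      then show ?thesis
        using prop_X[OF True] dom by (auto simp: sat_propagation_def P_def \<Gamma>_def)
    qed (simp add: P_def)
  qed
  then obtain b where "\<And>z. P b z (b z)" by blast
  then have b: "cell_interp S (b z)" "dom (b z) = X z"
      "cell_models S (I ++ (V b z ++ b z)) (fm_subst (hat_subst S xs z) Q)"
    if "z \<in> T" for z
    using that by (auto simp: P_def)

  \<comment> \<open>\<open>I\<close> takes priority, then the choice of the propagating tuple,
    unique by \<open>X_unique\<close>. The final default must be the same \<open>d\<close> as in
    \<open>V\<close>, so that \<open>J\<close> agrees with the inputs used during the
    recursion.\<close>
  define J where "J c = (case I c of Some v \<Rightarrow> v | None \<Rightarrow>
      if \<exists>z \<in> T. c \<in> X z then the (b (SOME z. z \<in> T \<and> c \<in> X z) c) else d)" for c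
  have JI: "I c = Some (J c)" if "c \<in> dom I" for c
    using that by (auto simp: J_def)
  have JX: "b z c = Some (J c)" if z: "z \<in> T" "c \<in> X z" for z c
  proof -
    have "(SOME z. z \<in> T \<and> c \<in> X z) = z"
      using z X_unique by (intro some_equality) blast+
    moreover have "I c = None" using XI z by blast
    moreover have "c \<in> dom (b z)" using b z by blast
    ultimately show ?thesis using z by (auto simp: J_def)
  qed
  have JV: "V b z c = Some (J c)" if z: "z \<in> T" and c: "c \<in> \<Gamma> z - dom I - X z" for z c
  proof (cases "\<exists>y. (y, z) \<in> R \<and> c \<in> X y")
    case True
    then obtain y where y: "(y, z) \<in> R" "c \<in> X y" by blast
    then show ?thesis using V_earlier[OF y c] JX RT by simp
  next
    case False
    \<comment> \<open>Earlier tuples are excluded by the case, \<open>z\<close> itself by the choice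
      of \<open>c\<close>, and later ones because \<open>c\<close> is relevant to
      \<open>z\<close>.\<close>
    then have "\<not> (\<exists>y \<in> T. c \<in> X y)"
      using total[of _ z] X_earlier z c by blast
    then have "J c = d" using c by (auto simp: J_def split: option.split)
    then show ?thesis using False c by (auto simp: V_def)
  qed
  have "J c \<in> cdom S" for c
  proof (cases "c \<in> dom I")
    case True
    then show ?thesis using JI[OF True] I by (auto simp: cell_interp_def dest: ranI)
  next
    case False
    show ?thesis
    proof (cases "\<exists>z \<in> T. c \<in> X z")
      case True
      then show ?thesis using JX b(1) by (meson cell_interp_def ranI subsetD)
    next
      case no_prop: False
      then show ?thesis using False d by (auto simp: J_def split: option.split)
    qed
  qed
  then have int: "interpretation_of S J (\<lambda>_::'v. e)"
    using e by (simp add: interpretation_of_def)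
  have "sat S J (\<lambda>_. e) F"
    using F int JI by (simp add: cell_models_def compatible_def)
  moreover have "sat S J (\<lambda>_. e) (Alls xs Q)"
  proof (unfold sat_Alls[OF assms(8)], fold T_def, rule ballI)
    fix z assume z: "z \<in> T"
    then have zD: "set z \<subseteq> ddom S" by (simp add: T_def tuples_def)
    \<comment> \<open>The three maps have disjoint domains and \<open>J\<close> extends each of
      them, so \<open>J\<close> is among the interpretations for which the propagator at
      \<open>z\<close> guarantees the instance of \<open>Q\<close>.\<close>
    have "(I ++ (V b z ++ b z)) c = Some (J c)" if "c \<in> dom (I ++ (V b z ++ b z))" for c
    proof (cases "c \<in> X z")
      case True
      then show ?thesis using JX[OF z True] by simp
    next
      case False
      then have bc: "b z c = None" using b(2)[OF z] by blast
      show ?thesis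
      proof (cases "c \<in> \<Gamma> z - dom I - X z")
        case True
        then show ?thesis using JV[OF z True] bc by (simp add: map_add_def)
      next
        case out: False
        then have "V b z c = None" unfolding V_def by (rule if_not_P)
        then show ?thesis using that bc JI[of c] by (simp add: map_add_def dom_def)
      qed
    qed
    then have "compatible S (I ++ (V b z ++ b z)) J (\<lambda>_::'v. e)"
      using int by (simp add: compatible_def)
    then have "sat S J (\<lambda>_. e) (fm_subst (hat_subst S xs z) Q)"
      using b(3)[OF z] by (simp add: cell_models_def)
    then show "sat S J (\<lambda>x. case map_of (zip xs z) x of None \<Rightarrow> e | Some a \<Rightarrow> a) Q"
      by (simp add: sat_fm_subst[OF assms(6)] eval_hat_subst[OF assms(1) zD, where \<sigma> = "\<lambda>_. e"])
  qed
  ultimately show ?thesis using int by (auto simp: satisfiable_def)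
qed

end
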